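(* Let $g:[0,1]\to\mathbb{R}$ be twice differentiable with $g'(0)=0$, $g'(1)=-1$ and $0<c_1\le|g''(x)|<c_2$ for all $x\in[0,1]$, for some constants $c_1,c_2$. Let $\Gamma$ be the graph of $g$. Then the series $F_\Gamma(s)$ converges for every real $s>2/3$ and diverges at $s=2/3$.
   Context: The hypotheses force $g$ to be strictly concave. The tangent to $\Gamma$ (the graph of $g$) at $(1,g(1))$ has slope $-1$ and the tangent at $(0,g(0))$ is horizontal. Choose equations $\alpha x+\beta y-\gamma_{1,0}=0$ of the tangent at $(1,g(1))$ and $\alpha'x+\beta'y-\gamma_{0,1}=0$ of the tangent at $(0,g(0))$ such that $\det\begin{pmatrix}\alpha&\beta\\ \alpha'&\beta'\end{pmatrix}=1$ and $\Gamma$ lies in the half-planes $\alpha x+\beta y-\gamma_{1,0}\le0$ and $\alpha'x+\beta'y-\gamma_{0,1}\le 0$ (for example $(\alpha,\beta)=(1,1)$, $(\alpha',\beta')=(0,1)$). The definition of $F_\Gamma$ is relative to such a choice. For coprime non-negative integers $a,b$, let $\gamma_{a,b}$ be the real number such that the line $(a\alpha+b\alpha')x+(a\beta+b\beta')y-\gamma_{a,b}=0$ is tangent to $\Gamma$, with $\Gamma$ contained in the half-plane where the left-hand side is $\le 0$. For $a,b,c,d\in\mathbb{Z}_{\ge0}$ with $ad-bc=1$, let $S_{a,b,c,d}$ be the area of the triangle $$(a\alpha+b\alpha')x+(a\beta+b\beta')y\le\gamma_{a,b},\quad (c\alpha+d\alpha')x+(c\beta+d\beta')y\le\gamma_{c,d},\quad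 ((a+c)\alpha+(b+d)\alpha')x+((a+c)\beta+(b+d)\beta')y\ge\gamma_{a+c,b+d}.$$ Put $f_\Gamma(a,b,c,d)=\sqrt{2S_{a,b,c,d}}$ and $$F_\Gamma(s)=\sum_{\substack{a,b,c,d\in\mathbb{Z}_{\ge0}\\ ad-bc=1}}f_\Gamma(a,b,c,d)^s .$$ *)

theory Defs
  imports "HOL-Analysis.Analysis"
begin

text \<open>
  The function \<open>g\<close> is only considered on \<open>[0,1]\<close>: derivatives are taken within \<open>{0..1}\<close>, hence
  one-sided at the endpoints.  A triple \<open>p q r\<close> stands for the line \<open>p x + q y - r = 0\<close>.
\<close>

text \<open>The condition \<open>p + q * D = 0\<close> says that the direction \<open>(1, D)\<close> of the graph is parallel to the line.\<close>

definition tangent_at :: "(real \<Rightarrow> real) \<Rightarrow> real \<Rightarrow> real \<Rightarrow> real \<Rightarrow> real \<Rightarrow> bool" where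
  "tangent_at g x p q r \<longleftrightarrow>
     (p, q) \<noteq> (0, 0) \<and> p * x + q * g x - r = 0 \<and>
     (\<exists>D. (g has_real_derivative D) (at x within {0..1}) \<and> p + q * D = 0)"

definition graph_in_halfplane :: "(real \<Rightarrow> real) \<Rightarrow> real \<Rightarrow> real \<Rightarrow> real \<Rightarrow> bool" where
  "graph_in_halfplane g p q r \<longleftrightarrow> (\<forall>x\<in>{0..1}. p * x + q * g x - r \<le> 0)"

definition admissible_choice ::
  "(real \<Rightarrow> real) \<Rightarrow> real \<Rightarrow> real \<Rightarrow> real \<Rightarrow> real \<Rightarrow> real \<Rightarrow> real \<Rightarrow> bool" where
  "admissible_choice g \<alpha> \<beta> \<gamma>10 \<alpha>' \<beta>' \<gamma>01 \<longleftrightarrow>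
     tangent_at g 1 \<alpha> \<beta> \<gamma>10 \<and> tangent_at g 0 \<alpha>' \<beta>' \<gamma>01 \<and>
     \<alpha> * \<beta>' - \<beta> * \<alpha>' = 1 \<and>
     graph_in_halfplane g \<alpha> \<beta> \<gamma>10 \<and> graph_in_halfplane g \<alpha>' \<beta>' \<gamma>01"

text \<open>
  At most one \<open>r\<close> qualifies below, since it must be the maximum of \<open>p x + q g(x)\<close> over \<open>[0,1]\<close>;
  in particular \<open>\<gamma>10\<close> and \<open>\<gamma>01\<close> of an admissible choice are recovered as the values at \<open>(1,0)\<close>
  and \<open>(0,1)\<close>.
\<close>

definition tangent_const ::
  "(real \<Rightarrow> real) \<Rightarrow> real \<Rightarrow> real \<Rightarrow> real \<Rightarrow> real \<Rightarrow> nat \<Rightarrow> nat \<Rightarrow> real" where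
  "tangent_const g \<alpha> \<beta> \<alpha>' \<beta>' a b =
     (let p = real a * \<alpha> + real b * \<alpha>'; q = real a * \<beta> + real b * \<beta>' in
      THE r. (\<exists>x\<in>{0..1}. tangent_at g x p q r) \<and> graph_in_halfplane g p q r)"

definition triangle ::
  "(real \<Rightarrow> real) \<Rightarrow> real \<Rightarrow> real \<Rightarrow> real \<Rightarrow> real \<Rightarrow> nat \<Rightarrow> nat \<Rightarrow> nat \<Rightarrow> nat \<Rightarrow> (real^2) set" where
  "triangle g \<alpha> \<beta> \<alpha>' \<beta>' a b c d =
     {v. (real a * \<alpha> + real b * \<alpha>') * v$1 + (real a * \<beta> + real b * \<beta>') * v$2
           \<le> tangent_const g \<alpha> \<beta> \<alpha>' \<beta>' a b \<and>
         (real c * \<alpha> + real d * \<alpha>') * v$1 + (real c * \<beta> + real d * \<beta>') * v$2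
           \<le> tangent_const g \<alpha> \<beta> \<alpha>' \<beta>' c d \<and>
         (real (a + c) * \<alpha> + real (b + d) * \<alpha>') * v$1 + (real (a + c) * \<beta> + real (b + d) * \<beta>') * v$2
           \<ge> tangent_const g \<alpha> \<beta> \<alpha>' \<beta>' (a + c) (b + d)}"

definition f_Gamma ::
  "(real \<Rightarrow> real) \<Rightarrow> real \<Rightarrow> real \<Rightarrow> real \<Rightarrow> real \<Rightarrow> nat \<Rightarrow> nat \<Rightarrow> nat \<Rightarrow> nat \<Rightarrow> real" where
  "f_Gamma g \<alpha> \<beta> \<alpha>' \<beta>' a b c d = sqrt (2 * measure lebesgue (triangle g \<alpha> \<beta> \<alpha>' \<beta>' a b c d))"

definition unimodular_quadruples :: "(nat \<times> nat \<times> nat \<times> nat) set" where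
  "unimodular_quadruples = {(a, b, c, d). int a * int d - int b * int c = 1}"

text \<open>
  The terms are non-negative, so unordered summability is convergence of the series in any order.
\<close>

definition F_Gamma_converges ::
  "(real \<Rightarrow> real) \<Rightarrow> real \<Rightarrow> real \<Rightarrow> real \<Rightarrow> real \<Rightarrow> real \<Rightarrow> bool" where
  "F_Gamma_converges g \<alpha> \<beta> \<alpha>' \<beta>' s \<longleftrightarrow>
     (\<lambda>(a, b, c, d). f_Gamma g \<alpha> \<beta> \<alpha>' \<beta>' a b c d powr s) summable_on unimodular_quadruples"

end

theory Submission
  imports Defs
begin

text \<open>
  An admissible choice has the form \<open>(\<alpha>, \<beta>) = (l, l)\<close>, \<open>(\<alpha>', \<beta>') = (0, 1/l)\<close> with \<open>l > 0\<close>. In unimodular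
  coordinates the triangle is an isosceles right triangle with legs
  \<open>\<gamma>\<^sub>a\<^sub>,\<^sub>b + \<gamma>\<^sub>c\<^sub>,\<^sub>d - \<gamma>\<^sub>a\<^sub>+\<^sub>c\<^sub>,\<^sub>b\<^sub>+\<^sub>d\<close>, so \<open>f_Gamma\<close> equals this defect. Uniform concavity makes the defect
  comparable to \<open>1 / (m n (m + n))\<close> with \<open>m = a + b\<close> and \<open>n = c + d\<close>. The map
  \<open>(a, b, c, d) \<mapsto> (m, n)\<close> is a bijection onto the coprime pairs of positive integers, so the series
  behaves like the sum of \<open>(m n (m + n))\<^sup>-\<^sup>s\<close> over coprime pairs, which converges exactly for \<open>s > 2/3\<close>.
\<close>

section \<open>Mean value theorem and triangle area\<close>

text \<open>Endpoints of the interval and both orders of \<open>x\<close> and \<open>y\<close> are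
  allowed, because a tangent point is later compared with points on either side of it.\<close>

lemma mvt_within_interval:
  fixes h h' :: "real \<Rightarrow> real"
  assumes deriv: "\<And>x. x \<in> {a..b} \<Longrightarrow> (h has_real_derivative h' x) (at x within {a..b})"
    and "x \<in> {a..b}" "y \<in> {a..b}"
  obtains z where "z \<in> closed_segment x y" "h y - h x = h' z * (y - x)"
proof -
  have *: "\<exists>z\<in>{x..y}. h y - h x = h' z * (y - x)"
    if "x \<le> y" "x \<in> {a..b}" "y \<in> {a..b}" for x y
  proof (rule mvt_very_simple[where f' = "\<lambda>z w. h' z * w", OF that(1)])
    fix z assume "x \<le> z" "z \<le> y"
    then have "(h has_real_derivative h' z) (at z within {x..y})"
      using that by (intro DERIV_subset[OF deriv]) auto
    then show "(h has_derivative (\<lambda>w. h' z * w)) (at z within {x..y})"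
      by (simp add: has_field_derivative_def)
  qed
  show thesis
  proof (cases "x \<le> y")
    case True
    then show thesis
      using *[of x y] assms(2,3) that by (auto simp: closed_segment_eq_real_ivl)
  next
    case False
    then obtain z where "z \<in> {y..x}" "h x - h y = h' z * (x - y)"
      using *[of y x] assms(2,3) by auto
    then show thesis
      using False by (intro that[of z]) (auto simp: closed_segment_eq_real_ivl algebra_simps)
  qed
qed

lemma measure_unimodular_triangle:
  fixes p1 q1 p2 q2 r1 r2 r3 :: real
  assumes det: "p1 * q2 - p2 * q1 = 1" and pos: "r1 + r2 - r3 > 0"
  shows "measure lebesgue {v :: real^2. p1 * v$1 + q1 * v$2 \<le> r1 \<and> p2 * v$1 + q2 * v$2 \<le> r2 \<and>
           (p1 + p2) * v$1 + (q1 + q2) * v$2 \<ge> r3} = (r1 + r2 - r3)\<^sup>2 / 2"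
proof -
  define f where "f = r1 + r2 - r3"
  \<comment> \<open>By Cramer's rule with determinant 1, \<open>P\<close> inverts the map from
    \<open>v\<close> to the values \<open>(s, t)\<close> of the two linear forms.\<close>
  define P where "P s t = (vector [q2 * s - q1 * t, p1 * t - p2 * s] :: real^2)" for s t
  have f: "f > 0" using pos by (simp add: f_def)
  have P_nth [simp]: "P s t $ 1 = q2 * s - q1 * t" "P s t $ 2 = p1 * t - p2 * s" for s t
    by (simp_all add: P_def)
  have P_rows: "p1 * P s t $ 1 + q1 * P s t $ 2 = s" "p2 * P s t $ 1 + q2 * P s t $ 2 = t" for s t
    using det by (simp_all, algebra+)
  have P_surj: "v = P (p1 * v$1 + q1 * v$2) (p2 * v$1 + q2 * v$2)" for v :: "real^2"
  proof -
    have "v$1 = q2 * (p1 * v$1 + q1 * v$2) - q1 * (p2 * v$1 + q2 * v$2)"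
      "v$2 = p1 * (p2 * v$1 + q2 * v$2) - p2 * (p1 * v$1 + q1 * v$2)"
      using det by algebra+
    then show ?thesis by (simp add: vec_eq_iff forall_2)
  qed
  \<comment> \<open>\<open>u\<close> and \<open>w\<close> measure, in units of \<open>f\<close>, the
    slack in the first two inequalities; the third becomes \<open>u + w \<le> 1\<close>.\<close>
  have comb: "P r1 r2 + u *\<^sub>R (P (r1 - f) r2 - P r1 r2) + w *\<^sub>R (P r1 (r2 - f) - P r1 r2)
      = P (r1 - u * f) (r2 - w * f)" for u w
    by (simp add: vec_eq_iff forall_2 algebra_simps)
  have "{v :: real^2. p1 * v$1 + q1 * v$2 \<le> r1 \<and> p2 * v$1 + q2 * v$2 \<le> r2 \<and>
           (p1 + p2) * v$1 + (q1 + q2) * v$2 \<ge> r3}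
      = convex hull {P r1 r2, P (r1 - f) r2, P r1 (r2 - f)}" (is "?T = ?H")
  proof (intro set_eqI iffI)
    fix v :: "real^2" assume v: "v \<in> ?T"
    define s where "s = p1 * v$1 + q1 * v$2"
    define t where "t = p2 * v$1 + q2 * v$2"
    have st: "s \<le> r1" "t \<le> r2" "s + t \<ge> r3"
      using v by (auto simp: s_def t_def algebra_simps)
    have "v = P (r1 - ((r1 - s) / f) * f) (r2 - ((r2 - t) / f) * f)"
      using P_surj[of v] f by (simp add: s_def t_def)
    moreover have "0 \<le> (r1 - s) / f" "0 \<le> (r2 - t) / f" "(r1 - s) / f + (r2 - t) / f \<le> 1"
      using st f by (simp_all add: add_divide_distrib[symmetric] f_def)
    ultimately show "v \<in> ?H"
      unfolding convex_hull_3_alt comb by blast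
  next
    fix v :: "real^2" assume "v \<in> ?H"
    then obtain u w where v: "v = P (r1 - u * f) (r2 - w * f)" and uw: "0 \<le> u" "0 \<le> w" "u + w \<le> 1"
      unfolding convex_hull_3_alt comb by blast
    have "(u + w) * f \<le> 1 * f" using uw f by (intro mult_right_mono) auto
    moreover have "0 \<le> u * f" "0 \<le> w * f" using uw f by auto
    moreover have "(p1 + p2) * v$1 + (q1 + q2) * v$2 = (p1 * v$1 + q1 * v$2) + (p2 * v$1 + q2 * v$2)"
      by (simp add: algebra_simps)
    ultimately show "v \<in> ?T"
      unfolding mem_Collect_eq v P_rows by (simp add: f_def algebra_simps)
  qed
  moreover have "?H \<in> sets lborel"
    by (simp add: borel_compact compact_convex_hull finite_imp_compact)
  ultimately have "measure lebesgue ?T = measure lborel ?H"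
    by (simp add: measure_completion)
  also have "\<dots> = \<bar>f\<^sup>2 * (p1 * q2 - p2 * q1)\<bar> / 2"
    by (simp add: content_triangle algebra_simps power2_eq_square abs_minus_commute)
  also have "\<dots> = f\<^sup>2 / 2" using det by simp
  finally show ?thesis by (simp add: f_def)
qed

section \<open>Unimodular quadruples and coprime pairs\<close>

text \<open>This is the subtractive Euclidean algorithm: undoing a subtraction adds one row of the
  matrix to the other, which keeps the determinant. It ends at \<open>m = n = 1\<close> with the
  identity matrix.\<close>

lemma unimodular_quadruple_exists:
  fixes m n :: nat
  assumes "0 < m" "0 < n" "coprime m n"
  shows "\<exists>a b c d. (a, b, c, d) \<in> unimodular_quadruples \<and> a + b = m \<and> c + d = n"
  using assms
proof (induction "m + n" arbitrary: m n rule: less_induct)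
  case less
  consider "m = n" | "m < n" | "n < m" by linarith
  then show ?case
  proof cases
    case 1
    with less.prems have "(1, 0, 0, 1) \<in> unimodular_quadruples \<and> 1 + 0 = m \<and> 0 + 1 = n"
      by (simp add: unimodular_quadruples_def)
    then show ?thesis by blast
  next
    case 2
    have "coprime m (n - m)"
      using less.prems 2 by (metis coprime_commute gcd_diff1_nat coprime_iff_gcd_eq_1 less_imp_le)
    with less.hyps[of m "n - m"] less.prems 2
    obtain a b c d where "(a, b, c, d) \<in> unimodular_quadruples" "a + b = m" "c + d = n - m" by auto
    with 2 have "(a, b, a + c, b + d) \<in> unimodular_quadruples \<and> a + b = m \<and> (a + c) + (b + d) = n"
      by (auto simp: unimodular_quadruples_def algebra_simps)
    then show ?thesis by blast
  next
    case 3
    have "coprime (m - n) n"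
      using less.prems 3 by (metis gcd_diff1_nat coprime_iff_gcd_eq_1 less_imp_le)
    with less.hyps[of "m - n" n] less.prems 3
    obtain a b c d where "(a, b, c, d) \<in> unimodular_quadruples" "a + b = m - n" "c + d = n" by auto
    with 3 have "(a + c, b + d, c, d) \<in> unimodular_quadruples \<and> (a + c) + (b + d) = m \<and> c + d = n"
      by (auto simp: unimodular_quadruples_def algebra_simps)
    then show ?thesis by blast
  qed
qed

text \<open>Adding the first column of the matrix to the second keeps the determinant and gives a
  Bezout identity for \<open>a + b\<close> and \<open>c + d\<close>.\<close>

lemma unimodular_quadrupleD:
  assumes "(a, b, c, d) \<in> unimodular_quadruples"
  shows "0 < a" "0 < d" "int a * int (c + d) - int (a + b) * int c = 1" "coprime (a + b) (c + d)"
proof -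
  have det: "int a * int d - int b * int c = 1"
    using assms by (simp add: unimodular_quadruples_def)
  show "0 < a" "0 < d"
    using det by (auto intro!: gr0I simp: of_nat_mult[symmetric] simp del: of_nat_mult)
  show *: "int a * int (c + d) - int (a + b) * int c = 1"
    using det by (simp add: algebra_simps)
  have "coprime (int (a + b)) (int (c + d))"
  proof (rule coprimeI)
    fix k assume "k dvd int (a + b)" "k dvd int (c + d)"
    then have "k dvd int a * int (c + d) - int (a + b) * int c"
      by (meson dvd_diff dvd_mult dvd_mult2)
    then show "is_unit k" unfolding * .
  qed
  then show "coprime (a + b) (c + d)" by (simp only: coprime_int_iff)
qed

text \<open>Injectivity is uniqueness of Bezout coefficients in a bounded range: subtracting two
  identities for the same sums shows that \<open>a + b\<close> divides
  \<open>a - a'\<close>.\<close>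

lemma bij_betw_unimodular_quadruples:
  "bij_betw (\<lambda>(a, b, c, d). (a + b, c + d)) unimodular_quadruples
     {(m, n). 0 < m \<and> 0 < n \<and> coprime m n}"
  unfolding bij_betw_def
proof
  have unique: "a = a' \<and> c = c'"
    if "(a, b, c, d) \<in> unimodular_quadruples" "(a', b', c', d') \<in> unimodular_quadruples"
      and sums: "a + b = a' + b'" "c + d = c' + d'" for a b c d a' b' c' d'
  proof -
    note D = unimodular_quadrupleD[OF that(1)] unimodular_quadrupleD[OF that(2)]
    have eq: "(int a - int a') * int (c + d) = int (a + b) * (int c - int c')"
      using D(3,7) unfolding sums by (simp add: algebra_simps)
    have "int (a + b) dvd (int a - int a') * int (c + d)" unfolding eq by (rule dvd_triv_left)
    moreover have "coprime (int (a + b)) (int (c + d))" using D(4) by (simp only: coprime_int_iff)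
    ultimately have dvd: "int (a + b) dvd int a - int a'"
      by (simp only: coprime_dvd_mult_left_iff)
    \<comment> \<open>Both \<open>a\<close> and \<open>a'\<close> lie between 1 and the modulus
      \<open>a + b\<close>.\<close>
    have "\<bar>int a - int a'\<bar> < int (a + b)" using D(1,5) sums by linarith
    then have "a = a'" using dvd_imp_le_int[OF _ dvd] by fastforce
    then have "int (a + b) * (int c - int c') = 0" using eq by simp
    with D(1) \<open>a = a'\<close> show ?thesis by simp
  qed
  show "inj_on (\<lambda>(a, b, c, d). (a + b, c + d)) unimodular_quadruples"
    by (rule inj_onI) (use unique in fastforce)
  show "(\<lambda>(a, b, c, d). (a + b, c + d)) ` unimodular_quadruples = {(m, n). 0 < m \<and> 0 < n \<and> coprime m n}"
  proof (intro set_eqI iffI)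
    fix p assume "p \<in> (\<lambda>(a, b, c, d). (a + b, c + d)) ` unimodular_quadruples"
    then show "p \<in> {(m, n). 0 < m \<and> 0 < n \<and> coprime m n}"
      by (auto dest: unimodular_quadrupleD)
  next
    fix p assume "p \<in> {(m, n). 0 < m \<and> 0 < n \<and> coprime m (n :: nat)}"
    then obtain m n where p: "p = (m, n)" "0 < m" "0 < n" "coprime m n" by auto
    then obtain a b c d where "(a, b, c, d) \<in> unimodular_quadruples" "a + b = m" "c + d = n"
      using unimodular_quadruple_exists by blast
    with p(1) show "p \<in> (\<lambda>(a, b, c, d). (a + b, c + d)) ` unimodular_quadruples"
      by (intro image_eqI[of _ _ "(a, b, c, d)"]) auto
  qed
qed

section \<open>Sums of a cubic form over pairs of integers\<close>

text \<open>Grouping pairs by their gcd relates sums over all positive pairs to sums over coprime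
  ones.\<close>

lemma bij_betw_scaled_coprime_pairs:
  "bij_betw (\<lambda>(k, m, n). (k * m, k * n)) ({0<..} \<times> {(m, n). 0 < m \<and> 0 < n \<and> coprime m n})
     ({0<..} \<times> {0<..} :: (nat \<times> nat) set)"
proof (rule bij_betw_byWitness[where f' = "\<lambda>(m, n). (gcd m n, m div gcd m n, n div gcd m n)"])
qed (auto simp: gcd_mult_left div_gcd_coprime dvd_div_eq_0_iff intro!: gr0I)

lemma summable_on_Times_mult:
  fixes f :: "'a \<Rightarrow> real" and g :: "'b \<Rightarrow> real"
  assumes "f summable_on A" "g summable_on B"
    and "\<And>x. x \<in> A \<Longrightarrow> 0 \<le> f x" "\<And>y. y \<in> B \<Longrightarrow> 0 \<le> g y"
  shows "(\<lambda>(x, y). f x * g y) summable_on A \<times> B"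
proof (rule summable_on_SigmaI)
  show "((\<lambda>y. case (x, y) of (x, y) \<Rightarrow> f x * g y) has_sum f x * infsum g B) B" for x
    using has_sum_infsum[OF assms(2)] by (auto intro: has_sum_cmult_right)
  show "(\<lambda>x. f x * infsum g B) summable_on A"
    using assms(1) by (rule summable_on_cmult_left)
qed (use assms in auto)

text \<open>Up to constant factors, \<open>f_Gamma\<close> will be the reciprocal of this form at
  \<open>(a + b, c + d)\<close>.\<close>

definition cubic_form :: "nat \<times> nat \<Rightarrow> real" where
  "cubic_form = (\<lambda>(m, n). real m * real n * (real m + real n))"

lemma cubic_form_nonneg: "0 \<le> cubic_form p"
  by (auto simp: cubic_form_def split: prod.split)

text \<open>Since \<open>(m + n)^2 \<ge> m * n\<close>, the form is at least
  \<open>(m * n) powr (3 / 2)\<close>. The double series is thus dominated by a product of two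
  series with exponent \<open>3 * s / 2 > 1\<close>.\<close>

lemma summable_on_cubic_form_powr:
  assumes "2 / 3 < s"
  shows "(\<lambda>p. cubic_form p powr - s) summable_on UNIV"
proof -
  define u where "u n = real n powr (- (3 * s / 2))" for n
  have "u summable_on UNIV"
    unfolding u_def using assms
    by (intro summable_nonneg_imp_summable_on) (auto simp: summable_real_powr_iff)
  then have "(\<lambda>(m, n). u m * u n) summable_on UNIV \<times> UNIV"
    by (intro summable_on_Times_mult) (auto simp: u_def[abs_def])
  then have "(\<lambda>(m, n). u m * u n) summable_on UNIV" by simp
  then show ?thesis
  proof (rule summable_on_comparison_test)
    fix p :: "nat \<times> nat"
    obtain m n where p: "p = (m, n)" by force
    show "cubic_form p powr - s \<le> (case p of (m, n) \<Rightarrow> u m * u n)"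
    proof (cases "m = 0 \<or> n = 0")
      case True
      \<comment> \<open>A power \<open>powr\<close> of 0 is 0, so pairs with a zero entry contribute
        nothing on either side.\<close>
      then show ?thesis by (auto simp: p cubic_form_def u_def)
    next
      case False
      define x where "x = real m * real n"
      have x: "0 < x" using False by (simp add: x_def)
      have "sqrt x \<le> sqrt ((real m + real n)\<^sup>2)"
        unfolding x_def by (intro real_sqrt_le_mono) (simp add: power2_eq_square algebra_simps)
      then have "x * sqrt x \<le> x * (real m + real n)"
        using x by (intro mult_left_mono) auto
      moreover have "x * sqrt x = x powr (3 / 2)"
        using x powr_add[of x 1 "1/2"] by (simp add: powr_half_sqrt)
      ultimately have "x powr (3 / 2) \<le> cubic_form p"
        by (simp add: p cubic_form_def x_def)
      then have "cubic_form p powr - s \<le> (x powr (3 / 2)) powr - s"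
        using assms x by (intro powr_mono2') auto
      also have "\<dots> = u m * u n"
        by (simp add: powr_powr u_def x_def powr_mult)
      finally show ?thesis by (simp add: p)
    qed
  qed auto
qed

text \<open>
  The form is homogeneous of degree 3, so the sum over all pairs is the sum over coprime pairs times
  \<open>\<zeta>(2)\<close>, and the sum over all pairs dominates the harmonic series.
\<close>

lemma not_summable_on_cubic_form_powr_coprime:
  "\<not> (\<lambda>p. cubic_form p powr - (2 / 3)) summable_on {(m, n). 0 < m \<and> 0 < n \<and> coprime m n}"
proof
  let ?C = "{(m, n). 0 < m \<and> 0 < n \<and> coprime m n} :: (nat \<times> nat) set"
  let ?h = "\<lambda>(k, m, n). (k * m, k * n) :: nat \<times> nat"
  have cube_powr: "(real k ^ 3) powr - (2 / 3) = real k powr -2" if "0 < k" for k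
  proof -
    have "real k ^ 3 = real k powr 3" using that by simp
    then show ?thesis by (simp only: powr_powr) simp
  qed
  define Q where "Q p = cubic_form p powr - (2 / 3)" for p
  assume "(\<lambda>p. cubic_form p powr - (2 / 3)) summable_on ?C"
  then have "Q summable_on ?C" unfolding Q_def .
  moreover have "(\<lambda>k. real k powr -2) summable_on {0<..}"
    by (rule summable_on_subset_banach[of _ UNIV], rule summable_nonneg_imp_summable_on)
      (auto simp: summable_real_powr_iff)
  ultimately have "(\<lambda>(k, p). real k powr -2 * Q p) summable_on {0<..} \<times> ?C"
    by (intro summable_on_Times_mult) (auto simp: Q_def[abs_def])
  also have "?this \<longleftrightarrow> (\<lambda>x. Q (?h x)) summable_on {0<..} \<times> ?C"
  proof (rule summable_on_cong)
    fix x :: "nat \<times> nat \<times> nat" assume "x \<in> {0<..} \<times> ?C"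
    then obtain k m n where x: "x = (k, m, n)" "0 < k" by auto
    have "cubic_form (k * m, k * n) = real k ^ 3 * cubic_form (m, n)"
      by (simp add: cubic_form_def power3_eq_cube algebra_simps)
    then show "(case x of (k, p) \<Rightarrow> real k powr -2 * Q p) = Q (?h x)"
      using x cubic_form_nonneg by (simp add: Q_def powr_mult cube_powr)
  qed
  also have "\<dots> \<longleftrightarrow> Q summable_on {0<..} \<times> {0<..}"
    by (rule summable_on_reindex_bij_betw[OF bij_betw_scaled_coprime_pairs])
  \<comment> \<open>On the part \<open>m \<le> n\<close> the form is at most \<open>2 * n^3\<close>.
    Row \<open>n\<close> has \<open>n\<close> terms, so it contributes at least a constant times
    \<open>1 / n\<close>.\<close>
  finally have "Q summable_on Sigma {0<..} (\<lambda>n. {1..n})"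
    by (rule summable_on_subset_banach) auto
  then have "(\<lambda>(n, m). 2 powr - (2 / 3) * real n powr -2) summable_on Sigma {0<..} (\<lambda>n. {1..n})"
  proof (rule summable_on_comparison_test)
    fix p :: "nat \<times> nat" assume "p \<in> Sigma {0<..} (\<lambda>n. {1..n})"
    then obtain n m where p: "p = (n, m)" "0 < n" "0 < m" "m \<le> n" by auto
    have "cubic_form p \<le> real n * real n * (real n + real n)"
      unfolding p cubic_form_def prod.case using p by (intro mult_mono) auto
    then have le: "cubic_form p \<le> 2 * real n ^ 3" by (simp add: power3_eq_cube)
    have pos: "0 < cubic_form p" using p by (simp add: cubic_form_def)
    have "2 powr - (2 / 3) * real n powr -2 = (2 * real n ^ 3) powr - (2 / 3)"
      using p(2) by (simp add: powr_mult cube_powr)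
    also have "\<dots> \<le> Q p"
      unfolding Q_def using le pos by (intro powr_mono2') auto
    finally show "(case p of (n, m) \<Rightarrow> 2 powr - (2 / 3) * real n powr -2) \<le> Q p" by (simp add: p)
  qed auto
  then have "(\<lambda>n. infsum (\<lambda>m. 2 powr - (2 / 3) * real n powr -2) {1..n}) summable_on {0<..}"
    by (rule summable_on_Sigma_banach)
  also have "?this \<longleftrightarrow> (\<lambda>n. 2 powr - (2 / 3) * real n powr -1) summable_on {0<..}"
  proof (rule summable_on_cong)
    fix n :: nat assume "n \<in> {0<..}"
    then have "2 powr - (2 / 3) * (real n * real n powr -2) = 2 powr - (2 / 3) * real n powr -1"
      using powr_add[of "real n" 1 "-2"] by simp
    then show "infsum (\<lambda>m. 2 powr - (2 / 3) * real n powr -2) {1..n} = 2 powr - (2 / 3) * real n powr -1"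
      by (simp add: mult.left_commute)
  qed
  \<comment> \<open>The added term at \<open>n = 0\<close> vanishes because
    \<open>0 powr -1 = 0\<close>.\<close>
  also have "\<dots> \<longleftrightarrow> (\<lambda>n. 2 powr - (2 / 3) * real n powr -1) summable_on UNIV"
    by (rule summable_on_cong_neutral) auto
  finally have "summable (\<lambda>n. 2 powr - (2 / 3) * real n powr -1)"
    by (rule summable_on_imp_summable)
  then have "summable (\<lambda>n. real n powr -1)" by (subst (asm) summable_cmult_iff) simp
  then show False unfolding summable_real_powr_iff by simp
qed

section \<open>Tangents of a uniformly concave arc\<close>

text \<open>The second derivative is replaced by two-sided bounds on the decrease of
  \<open>g'\<close>, which already carry its sign.\<close>

locale concave_arc =
  fixes g g' :: "real \<Rightarrow> real" and c1 c2 :: real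
  assumes deriv: "x \<in> {0..1} \<Longrightarrow> (g has_real_derivative g' x) (at x within {0..1})"
    and continuous_deriv: "continuous_on {0..1} g'"
    and deriv_0: "g' 0 = 0" and deriv_1: "g' 1 = -1"
    and c1_pos: "0 < c1"
    and slope_lower: "\<lbrakk>0 \<le> x; x \<le> y; y \<le> 1\<rbrakk> \<Longrightarrow> c1 * (y - x) \<le> g' x - g' y"
    and slope_upper: "\<lbrakk>0 \<le> x; x \<le> y; y \<le> 1\<rbrakk> \<Longrightarrow> g' x - g' y \<le> c2 * (y - x)"
begin

lemma c1_le_c2: "c1 \<le> c2"
  using slope_lower[of 0 1] slope_upper[of 0 1] by simp

lemma c2_pos: "0 < c2"
  using c1_pos c1_le_c2 by simp

text \<open>The gap between tangent and graph minus \<open>c / 2 * (y - x)^2\<close> vanishes at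
  \<open>y = x\<close>. The slope bounds control the sign of its derivative for
  \<open>c = c1\<close> and \<open>c = c2\<close>.\<close>

lemma tangent_gap_bounds:
  assumes "x \<in> {0..1}" "y \<in> {0..1}"
  shows "c1 / 2 * (y - x)\<^sup>2 \<le> g x + g' x * (y - x) - g y"
    and "g x + g' x * (y - x) - g y \<le> c2 / 2 * (y - x)\<^sup>2"
proof -
  have gap: "\<exists>z\<in>closed_segment x y. g x + g' x * (y - x) - g y - c / 2 * (y - x)\<^sup>2
      = (g' x - g' z - c * (z - x)) * (y - x)" for c
  proof -
    define h where "h z = g x + g' x * (z - x) - g z - c / 2 * (z - x)\<^sup>2" for z
    have "(h has_real_derivative (g' x - g' z - c * (z - x))) (at z within {0..1})"
      if "z \<in> {0..1}" for z
      unfolding h_def using deriv[OF that]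
      by (auto intro!: derivative_eq_intros simp: field_simps)
    from mvt_within_interval[OF this assms] obtain z where "z \<in> closed_segment x y"
      "h y - h x = (g' x - g' z - c * (z - x)) * (y - x)" by auto
    then show ?thesis by (auto simp: h_def)
  qed
  have seg: "0 \<le> z \<and> z \<le> 1 \<and> (x \<le> z \<and> z \<le> y \<or> y \<le> z \<and> z \<le> x)"
    if "z \<in> closed_segment x y" for z
    using that assms by (auto simp: closed_segment_eq_real_ivl split: if_splits)
  obtain z where z: "z \<in> closed_segment x y"
    "g x + g' x * (y - x) - g y - c1 / 2 * (y - x)\<^sup>2 = (g' x - g' z - c1 * (z - x)) * (y - x)"
    using gap by blast
  \<comment> \<open>Both factors change sign together as \<open>y\<close> passes from one side of
    \<open>x\<close> to the other.\<close>
  have "0 \<le> (g' x - g' z - c1 * (z - x)) * (y - x)"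
    unfolding zero_le_mult_iff
    using seg[OF z(1)] slope_lower[of x z] slope_lower[of z x] assms by (auto simp: algebra_simps)
  then show "c1 / 2 * (y - x)\<^sup>2 \<le> g x + g' x * (y - x) - g y" using z(2) by simp
  obtain z where z: "z \<in> closed_segment x y"
    "g x + g' x * (y - x) - g y - c2 / 2 * (y - x)\<^sup>2 = (g' x - g' z - c2 * (z - x)) * (y - x)"
    using gap by blast
  have "(g' x - g' z - c2 * (z - x)) * (y - x) \<le> 0"
    unfolding mult_le_0_iff
    using seg[OF z(1)] slope_upper[of x z] slope_upper[of z x] assms by (auto simp: algebra_simps)
  then show "g x + g' x * (y - x) - g y \<le> c2 / 2 * (y - x)\<^sup>2" using z(2) by simp
qed

text \<open>This trades distances between tangent points, which are not explicit, for differences of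
  slopes, which are determined by the lines.\<close>

lemma slope_square_bounds:
  assumes "x \<in> {0..1}" "y \<in> {0..1}"
  shows "(g' x - g' y)\<^sup>2 / c2\<^sup>2 \<le> (y - x)\<^sup>2" and "(y - x)\<^sup>2 \<le> (g' x - g' y)\<^sup>2 / c1\<^sup>2"
proof -
  have ordered: "c1 * \<bar>y - x\<bar> \<le> \<bar>g' x - g' y\<bar> \<and> \<bar>g' x - g' y\<bar> \<le> c2 * \<bar>y - x\<bar>"
    if "0 \<le> x" "x \<le> y" "y \<le> 1" for x y
  proof -
    have "0 \<le> c1 * (y - x)" using c1_pos that by simp
    with slope_lower[OF that] slope_upper[OF that] that show ?thesis by simp
  qed
  have "c1 * \<bar>y - x\<bar> \<le> \<bar>g' x - g' y\<bar> \<and> \<bar>g' x - g' y\<bar> \<le> c2 * \<bar>y - x\<bar>"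
    using ordered[of x y] ordered[of y x] assms by (cases "x \<le> y") (auto simp: abs_minus_commute)
  then have "(c1 * \<bar>y - x\<bar>)\<^sup>2 \<le> \<bar>g' x - g' y\<bar>\<^sup>2" "\<bar>g' x - g' y\<bar>\<^sup>2 \<le> (c2 * \<bar>y - x\<bar>)\<^sup>2"
    using c1_pos by (meson abs_ge_zero mult_nonneg_nonneg order_less_imp_le power_mono)+
  then show "(g' x - g' y)\<^sup>2 / c2\<^sup>2 \<le> (y - x)\<^sup>2" "(y - x)\<^sup>2 \<le> (g' x - g' y)\<^sup>2 / c1\<^sup>2"
    using c1_pos c2_pos by (auto simp: field_simps power_mult_distrib)
qed

text \<open>With \<open>p = - q * g' x\<close>, the difference is \<open>q\<close> times the gap
  between the tangent at \<open>x\<close> and the graph at \<open>y\<close>.\<close>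

lemma scaled_gap_bounds:
  assumes "x \<in> {0..1}" "y \<in> {0..1}" "0 < q" "p + q * g' x = 0"
  shows "c1 / (2 * c2\<^sup>2) * (q * (g' x - g' y)\<^sup>2) \<le> (p * x + q * g x) - (p * y + q * g y)"
    and "(p * x + q * g x) - (p * y + q * g y) \<le> c2 / (2 * c1\<^sup>2) * (q * (g' x - g' y)\<^sup>2)"
proof -
  have eq: "(p * x + q * g x) - (p * y + q * g y) = q * (g x + g' x * (y - x) - g y)"
    using assms(4) by algebra
  have "c1 / 2 * ((g' x - g' y)\<^sup>2 / c2\<^sup>2) \<le> c1 / 2 * (y - x)\<^sup>2"
    using slope_square_bounds[OF assms(1,2)] c1_pos by (intro mult_left_mono) auto
  also have "\<dots> \<le> g x + g' x * (y - x) - g y" by (rule tangent_gap_bounds[OF assms(1,2)])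
  finally have "q * (c1 / 2 * ((g' x - g' y)\<^sup>2 / c2\<^sup>2)) \<le> q * (g x + g' x * (y - x) - g y)"
    using assms(3) by (intro mult_left_mono) auto
  then show "c1 / (2 * c2\<^sup>2) * (q * (g' x - g' y)\<^sup>2) \<le> (p * x + q * g x) - (p * y + q * g y)"
    unfolding eq by (simp add: mult_ac)
  have "g x + g' x * (y - x) - g y \<le> c2 / 2 * (y - x)\<^sup>2" by (rule tangent_gap_bounds[OF assms(1,2)])
  also have "\<dots> \<le> c2 / 2 * ((g' x - g' y)\<^sup>2 / c1\<^sup>2)"
    using slope_square_bounds[OF assms(1,2)] c2_pos by (intro mult_left_mono) auto
  finally have "q * (g x + g' x * (y - x) - g y) \<le> q * (c2 / 2 * ((g' x - g' y)\<^sup>2 / c1\<^sup>2))"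
    using assms(3) by (intro mult_left_mono) auto
  then show "(p * x + q * g x) - (p * y + q * g y) \<le> c2 / (2 * c1\<^sup>2) * (q * (g' x - g' y)\<^sup>2)"
    unfolding eq by (simp add: mult_ac)
qed

text \<open>This supplies the tangent points: \<open>- p / q\<close> lies between
  \<open>g' 1 = -1\<close> and \<open>g' 0 = 0\<close>, so the intermediate value theorem
  applies.\<close>

lemma deriv_surj:
  assumes "0 \<le> p" "p \<le> q" "0 < q"
  obtains x where "x \<in> {0..1}" "p + q * g' x = 0"
proof -
  have "\<exists>x. 0 \<le> x \<and> x \<le> 1 \<and> g' x = - p / q"
    using assms continuous_deriv by (intro IVT2') (auto simp: deriv_0 deriv_1 field_simps)
  then obtain x where "0 \<le> x" "x \<le> 1" "g' x = - p / q" by blast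
  with assms that[of x] show thesis by auto
qed

text \<open>Concavity puts the graph below its tangent. The constant is unique because each
  half-plane condition can be evaluated at the touching point of the other line.\<close>

lemma tangent_const_eq:
  assumes p: "p = real a * \<alpha> + real b * \<alpha>'" and q: "q = real a * \<beta> + real b * \<beta>'"
    and "0 < q" and x: "x \<in> {0..1}" and px: "p + q * g' x = 0"
  shows "tangent_const g \<alpha> \<beta> \<alpha>' \<beta>' a b = p * x + q * g x"
  unfolding tangent_const_def Let_def p[symmetric] q[symmetric]
proof (rule the_equality, intro conjI bexI[OF _ x])
  show "tangent_at g x p q (p * x + q * g x)"
    unfolding tangent_at_def using deriv[OF x] px \<open>0 < q\<close> by auto
  show half: "graph_in_halfplane g p q (p * x + q * g x)"
    unfolding graph_in_halfplane_def
  proof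
    fix y :: real assume y: "y \<in> {0..1}"
    have "0 \<le> c1 / (2 * c2\<^sup>2) * (q * (g' x - g' y)\<^sup>2)" using c1_pos \<open>0 < q\<close> by simp
    with scaled_gap_bounds(1)[OF x y \<open>0 < q\<close> px] show "p * y + q * g y - (p * x + q * g x) \<le> 0" by simp
  qed
  fix r assume r: "(\<exists>x\<in>{0..1}. tangent_at g x p q r) \<and> graph_in_halfplane g p q r"
  then obtain y where "y \<in> {0..1}" "p * y + q * g y - r = 0" by (auto simp: tangent_at_def)
  with half r x show "r = p * x + q * g x"
    unfolding graph_in_halfplane_def by force
qed

text \<open>The two tangent slopes and the determinant leave one parameter up to sign. Its sign
  comes from the half-plane of the horizontal tangent, evaluated at \<open>x = 1\<close>, where
  \<open>g 1 < g 0\<close>.\<close>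

lemma admissible_choice_cases:
  assumes "admissible_choice g \<alpha> \<beta> \<gamma>10 \<alpha>' \<beta>' \<gamma>01"
  shows "0 < \<alpha> \<and> \<beta> = \<alpha> \<and> \<alpha>' = 0 \<and> \<beta>' = 1 / \<alpha>"
proof -
  note adm = assms[unfolded admissible_choice_def tangent_at_def graph_in_halfplane_def]
  have uniq: "D = g' x" if "(g has_real_derivative D) (at x within {0..1})" "x \<in> {0..1}" for D x
    using that deriv[OF that(2)]
    by (intro has_field_derivative_unique) (auto simp: trivial_limit_within islimpt_Icc)
  have "\<alpha> + \<beta> * g' 1 = 0" "\<alpha>' + \<beta>' * g' 0 = 0"
    using adm uniq by fastforce+
  then have eqs: "\<beta> = \<alpha>" "\<alpha>' = 0" by (simp_all add: deriv_0 deriv_1)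
  then have det: "\<alpha> * \<beta>' = 1" using adm by simp
  have "\<beta>' * g 1 \<le> \<beta>' * g 0" using adm eqs by force
  moreover have "g 1 < g 0"
    using tangent_gap_bounds(1)[of 0 1] c1_pos by (simp add: deriv_0)
  ultimately have "0 \<le> \<beta>'" by (metis mult_le_cancel_left_neg not_le)
  moreover have "\<beta>' \<noteq> 0" using det by auto
  ultimately have "0 < \<beta>'" by simp
  with det have "0 < \<alpha>" using zero_less_mult_pos2[of \<alpha> \<beta>'] by simp
  with det eqs show ?thesis by (simp add: field_simps)
qed

text \<open>
  Unimodularity enters through \<open>p\<^sub>1 q\<^sub>2 - p\<^sub>2 q\<^sub>1 = 1\<close>: the slopes of the tangents at \<open>x\<^sub>i\<close> and \<open>x\<^sub>3\<close> differ by
  \<open>1 / (q\<^sub>i (q\<^sub>1 + q\<^sub>2))\<close>, so the gaps are comparable to \<open>1 / (q\<^sub>i (q\<^sub>1 + q\<^sub>2)\<^sup>2)\<close>, and the two add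
  up to \<open>1 / (q\<^sub>1 q\<^sub>2 (q\<^sub>1 + q\<^sub>2))\<close>.
\<close>

lemma f_Gamma_bounds:
  fixes a b c d :: nat
  assumes "0 < l" and det: "real a * real d - real b * real c = 1"
  defines "q1 \<equiv> real a * l + real b * (1 / l)" and "q2 \<equiv> real c * l + real d * (1 / l)"
  shows "c1 / (2 * c2\<^sup>2) / (q1 * q2 * (q1 + q2)) \<le> f_Gamma g l l 0 (1 / l) a b c d"
    and "f_Gamma g l l 0 (1 / l) a b c d \<le> c2 / (2 * c1\<^sup>2) / (q1 * q2 * (q1 + q2))"
proof -
  \<comment> \<open>The vanishing summands keep the shape of the coefficients in
    \<open>triangle\<close> and \<open>tangent_const\<close> at
    \<open>\<alpha>' = 0\<close>.\<close>
  define p1 p2 where "p1 = real a * l + real b * 0" and "p2 = real c * l + real d * 0"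
  have "a \<noteq> 0" "d \<noteq> 0" using det by (auto simp: of_nat_mult[symmetric] simp del: of_nat_mult intro!: gr0I)
  then have q_pos: "0 < q1" "0 < q2" using \<open>0 < l\<close> 
    by (simp_all add: q1_def q2_def add_pos_nonneg add_nonneg_pos)
  have p_le: "0 \<le> p1" "p1 \<le> q1" "0 \<le> p2" "p2 \<le> q2"
    using \<open>0 < l\<close> by (auto simp: p1_def p2_def q1_def q2_def)
  have unimod: "p1 * q2 - p2 * q1 = 1"
    using det \<open>0 < l\<close> by (simp add: p1_def p2_def q1_def q2_def field_simps)
  obtain x1 where x1: "x1 \<in> {0..1}" "p1 + q1 * g' x1 = 0" using deriv_surj p_le q_pos by blast
  obtain x2 where x2: "x2 \<in> {0..1}" "p2 + q2 * g' x2 = 0" using deriv_surj p_le q_pos by blast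
  obtain x3 where x3: "x3 \<in> {0..1}" "(p1 + p2) + (q1 + q2) * g' x3 = 0"
    using deriv_surj[of "p1 + p2" "q1 + q2"] p_le q_pos by auto
  \<comment> \<open>This is the defect of the three tangent constants. The third constant is split
    at its touching point \<open>x3\<close> into the values of the first two linear forms, leaving
    two gaps of the kind already estimated.\<close>
  define gap where "gap = ((p1 * x1 + q1 * g x1) - (p1 * x3 + q1 * g x3))
    + ((p2 * x2 + q2 * g x2) - (p2 * x3 + q2 * g x3))"
  have slopes: "g' x1 = - p1 / q1" "g' x2 = - p2 / q2" "g' x3 = - (p1 + p2) / (q1 + q2)"
    using x1(2) x2(2) x3(2) q_pos by (auto simp: field_simps)
  have "g' x1 - g' x3 = - (p1 * q2 - p2 * q1) / (q1 * (q1 + q2))"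
    "g' x2 - g' x3 = (p1 * q2 - p2 * q1) / (q2 * (q1 + q2))"
    unfolding slopes using q_pos by (simp_all add: field_simps)
  then have diffs: "(g' x1 - g' x3)\<^sup>2 = 1 / (q1 * (q1 + q2))\<^sup>2" "(g' x2 - g' x3)\<^sup>2 = 1 / (q2 * (q1 + q2))\<^sup>2"
    unfolding unimod by (simp_all add: power_divide)
  have "q1 * (g' x1 - g' x3)\<^sup>2 + q2 * (g' x2 - g' x3)\<^sup>2 = 1 / (q1 * (q1 + q2)\<^sup>2) + 1 / (q2 * (q1 + q2)\<^sup>2)"
    unfolding diffs using q_pos by (simp add: power2_eq_square mult_ac)
  also have "\<dots> = (q1 + q2) / (q1 * q2 * (q1 + q2)\<^sup>2)"
    using q_pos by (simp add: field_simps)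
  also have "\<dots> = 1 / (q1 * q2 * (q1 + q2))"
    using q_pos by (simp add: power2_eq_square)
  finally have sum: "q1 * (g' x1 - g' x3)\<^sup>2 + q2 * (g' x2 - g' x3)\<^sup>2 = 1 / (q1 * q2 * (q1 + q2))" .
  have gap_bounds: "c1 / (2 * c2\<^sup>2) * (1 / (q1 * q2 * (q1 + q2))) \<le> gap"
    "gap \<le> c2 / (2 * c1\<^sup>2) * (1 / (q1 * q2 * (q1 + q2)))"
    using scaled_gap_bounds[OF x1(1) x3(1) q_pos(1) x1(2)] scaled_gap_bounds[OF x2(1) x3(1) q_pos(2) x2(2)]
    unfolding sum[symmetric] gap_def by (simp_all only: distrib_left)
  have gap_pos: "0 < gap"
    by (rule less_le_trans[OF _ gap_bounds(1)]) (use q_pos c1_pos c2_pos in simp)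
  have p3: "real (a + c) * l + real (b + d) * 0 = p1 + p2" by (simp add: p1_def p2_def algebra_simps)
  have q3: "real (a + c) * l + real (b + d) * (1 / l) = q1 + q2"
    by (simp add: q1_def q2_def algebra_simps add_divide_distrib)
  have r1: "tangent_const g l l 0 (1 / l) a b = p1 * x1 + q1 * g x1"
    using x1 q_pos by (intro tangent_const_eq) (simp_all add: p1_def q1_def)
  have r2: "tangent_const g l l 0 (1 / l) c d = p2 * x2 + q2 * g x2"
    using x2 q_pos by (intro tangent_const_eq) (simp_all add: p2_def q2_def)
  have r3: "tangent_const g l l 0 (1 / l) (a + c) (b + d) = (p1 + p2) * x3 + (q1 + q2) * g x3"
    using x3 q_pos by (intro tangent_const_eq[OF p3[symmetric] q3[symmetric]]) simp_all
  have gap: "gap = (p1 * x1 + q1 * g x1) + (p2 * x2 + q2 * g x2) - ((p1 + p2) * x3 + (q1 + q2) * g x3)"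
    by (simp add: gap_def algebra_simps)
  have "measure lebesgue (triangle g l l 0 (1 / l) a b c d) = gap\<^sup>2 / 2"
    unfolding triangle_def r1 r2 r3 p3 q3 p1_def[symmetric] p2_def[symmetric] q1_def[symmetric] q2_def[symmetric]
    unfolding gap by (rule measure_unimodular_triangle) (use unimod gap_pos gap in simp_all)
  then have "f_Gamma g l l 0 (1 / l) a b c d = gap"
    using gap_pos by (simp add: f_Gamma_def del: eq_divide_eq_numeral1)
  with gap_bounds show "c1 / (2 * c2\<^sup>2) / (q1 * q2 * (q1 + q2)) \<le> f_Gamma g l l 0 (1 / l) a b c d"
    "f_Gamma g l l 0 (1 / l) a b c d \<le> c2 / (2 * c1\<^sup>2) / (q1 * q2 * (q1 + q2))"
    by simp_all
qed

text \<open>Each \<open>q\<close> is a combination of \<open>l\<close> and \<open>1 / l\<close> with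
  weights \<open>a\<close> and \<open>b\<close>, hence comparable to \<open>a + b\<close>. The
  parameter \<open>l\<close> thus affects only constants, cubed because the form has degree
  3.\<close>

lemma f_Gamma_comparable:
  assumes "0 < l"
  obtains k K where "0 < k" "0 < K"
    "\<And>a b c d. (a, b, c, d) \<in> unimodular_quadruples \<Longrightarrow>
       k / cubic_form (a + b, c + d) \<le> f_Gamma g l l 0 (1 / l) a b c d \<and>
       f_Gamma g l l 0 (1 / l) a b c d \<le> K / cubic_form (a + b, c + d)"
proof
  let ?k = "c1 / (2 * c2\<^sup>2)" and ?K = "c2 / (2 * c1\<^sup>2)"
  define lo hi where "lo = min l (1 / l)" and "hi = max l (1 / l)"
  have pos: "0 < lo" "0 < hi" "0 < ?k" "0 < ?K"
    using assms c1_pos c2_pos by (auto simp: lo_def hi_def less_max_iff_disj)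
  show "0 < ?k / hi ^ 3" "0 < ?K / lo ^ 3"
    by (intro divide_pos_pos pos zero_less_power)+
  have q_bounds: "lo * real (a + b) \<le> real a * l + real b * (1 / l)"
    "real a * l + real b * (1 / l) \<le> hi * real (a + b)" for a b
  proof -
    have "real a * lo + real b * lo \<le> real a * l + real b * (1 / l)"
      by (intro add_mono mult_left_mono) (auto simp: lo_def)
    moreover have "real a * l + real b * (1 / l) \<le> real a * hi + real b * hi"
      by (intro add_mono mult_left_mono) (auto simp: hi_def)
    ultimately show "lo * real (a + b) \<le> real a * l + real b * (1 / l)"
      "real a * l + real b * (1 / l) \<le> hi * real (a + b)" by (simp_all add: algebra_simps)
  qed
  fix a b c d assume quad: "(a, b, c, d) \<in> unimodular_quadruples"
  define m n where "m = real (a + b)" and "n = real (c + d)"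
  define q1 q2 where "q1 = real a * l + real b * (1 / l)" and "q2 = real c * l + real d * (1 / l)"
  have mn: "0 < m" "0 < n" using unimodular_quadrupleD[OF quad] by (auto simp: m_def n_def)
  have q: "lo * m \<le> q1" "q1 \<le> hi * m" "lo * n \<le> q2" "q2 \<le> hi * n"
    using q_bounds by (simp_all only: m_def n_def q1_def q2_def)
  have q_pos: "0 < q1" "0 < q2"
    using q(1,3) mn pos by (meson less_le_trans mult_pos_pos)+
  have cubic: "cubic_form (a + b, c + d) = m * n * (m + n)"
    by (simp add: cubic_form_def m_def n_def)
  have "(lo * m) * (lo * n) * (lo * m + lo * n) \<le> q1 * q2 * (q1 + q2)"
    using q q_pos mn pos by (intro mult_mono add_mono) auto
  then have lower: "lo ^ 3 * cubic_form (a + b, c + d) \<le> q1 * q2 * (q1 + q2)"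
    by (simp add: cubic power3_eq_cube algebra_simps)
  have "q1 * q2 * (q1 + q2) \<le> (hi * m) * (hi * n) * (hi * m + hi * n)"
    using q q_pos mn pos by (intro mult_mono add_mono) auto
  then have upper: "q1 * q2 * (q1 + q2) \<le> hi ^ 3 * cubic_form (a + b, c + d)"
    by (simp add: cubic power3_eq_cube algebra_simps)
  have cubic_pos: "0 < cubic_form (a + b, c + d)" using mn by (simp add: cubic)
  have "int a * int d - int b * int c = 1" using quad by (simp add: unimodular_quadruples_def)
  then have "real_of_int (int a * int d - int b * int c) = 1" by simp
  then have det: "real a * real d - real b * real c = 1" by simp
  note bounds = f_Gamma_bounds[OF assms det, folded q1_def q2_def]
  have "?k / hi ^ 3 / cubic_form (a + b, c + d) = ?k / (hi ^ 3 * cubic_form (a + b, c + d))" by simp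
  also have "\<dots> \<le> ?k / (q1 * q2 * (q1 + q2))"
    using upper q_pos pos cubic_pos by (intro divide_left_mono) auto
  also note bounds(1)
  finally have below: "?k / hi ^ 3 / cubic_form (a + b, c + d) \<le> f_Gamma g l l 0 (1 / l) a b c d" .
  note bounds(2)
  also have "?K / (q1 * q2 * (q1 + q2)) \<le> ?K / (lo ^ 3 * cubic_form (a + b, c + d))"
    using lower q_pos pos cubic_pos by (intro divide_left_mono) auto
  also have "\<dots> = ?K / lo ^ 3 / cubic_form (a + b, c + d)" by simp
  finally show "?k / hi ^ 3 / cubic_form (a + b, c + d) \<le> f_Gamma g l l 0 (1 / l) a b c d \<and>
       f_Gamma g l l 0 (1 / l) a b c d \<le> ?K / lo ^ 3 / cubic_form (a + b, c + d)"
    using below by simp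
qed

end

section \<open>Uniform concavity from the second derivative\<close>

text \<open>Only the absolute value of \<open>g''\<close> is bounded, and \<open>g''\<close> need
  not be continuous. Once \<open>g'\<close> is known to decrease, the mean value theorem gives both
  slope bounds.\<close>

lemma concave_arcI:
  fixes g g' g'' :: "real \<Rightarrow> real"
  assumes deriv: "\<And>x. x \<in> {0..1} \<Longrightarrow> (g has_real_derivative g' x) (at x within {0..1})"
    and deriv2: "\<And>x. x \<in> {0..1} \<Longrightarrow> (g' has_real_derivative g'' x) (at x within {0..1})"
    and "g' 0 = 0" and "g' 1 = -1"
    and "0 < c1" and bounds: "\<And>x. x \<in> {0..1} \<Longrightarrow> c1 \<le> \<bar>g'' x\<bar> \<and> \<bar>g'' x\<bar> < c2"
  shows "concave_arc g g' c1 c2"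
proof -
  have cont: "continuous_on {0..1} g'"
    using deriv2 by (meson DERIV_continuous_on)
  have mvt: "\<exists>z. z \<in> {x..y} \<and> z \<in> {0..1} \<and> g' y - g' x = g'' z * (y - x)"
    if "0 \<le> x" "x \<le> y" "y \<le> 1" for x y
  proof -
    have "x \<in> {0..1}" "y \<in> {0..1}" using that by auto
    from mvt_within_interval[OF deriv2 this]
    obtain z where "z \<in> closed_segment x y" "g' y - g' x = g'' z * (y - x)" by blast
    with that show ?thesis by (auto simp: closed_segment_eq_real_ivl)
  qed
  have ne: "g' x \<noteq> g' y" if "0 \<le> x" "x < y" "y \<le> 1" for x y
  proof -
    from mvt[of x y] that obtain z where "z \<in> {0..1}" "g' y - g' x = g'' z * (y - x)" by auto
    with bounds[of z] \<open>0 < c1\<close> that show ?thesis by auto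
  qed
  have inj: "inj_on g' {0..1}"
  proof (rule inj_onI)
    fix x y :: real assume "x \<in> {0..1}" "y \<in> {0..1}" "g' x = g' y"
    then show "x = y" using ne[of x y] ne[of y x] by (cases x y rule: linorder_cases) auto
  qed
  \<comment> \<open>An injective continuous function is monotone, which fixes the sign of \<open>g''\<close> without Darboux's theorem.\<close>
  have decr: "g' y < g' x" if "0 \<le> x" "x < y" "y \<le> 1" for x y
  proof -
    \<comment> \<open>On the triple 0, \<open>y\<close>, 1 the known end values decide the direction
      of monotonicity; the triple 0, \<open>x\<close>, \<open>y\<close> then carries it to all
      pairs.\<close>
    have le0: "g' y < g' 0" if "0 < y" "y \<le> 1" for y
      using continuous_inj_imp_mono[of 0 y 1 g'] cont inj that assms(3,4) by (cases "y = 1") auto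
    show ?thesis
    proof (cases "x = 0")
      case False
      have "continuous_on {0..y} g'" "inj_on g' {0..y}"
        using cont inj that by (auto intro: continuous_on_subset inj_on_subset)
      then show ?thesis
        using continuous_inj_imp_mono[of 0 x y g'] le0[of y] le0[of x] that False by auto
    qed (use le0 that in auto)
  qed
  have slope: "c1 * (y - x) \<le> g' x - g' y \<and> g' x - g' y \<le> c2 * (y - x)"
    if "0 \<le> x" "x \<le> y" "y \<le> 1" for x y
  proof (cases "x = y")
    case False
    with that have "x < y" by simp
    from mvt[of x y] that obtain z where z: "z \<in> {0..1}" "g' y - g' x = g'' z * (y - x)" by auto
    with decr[of x y] that \<open>x < y\<close> have "g'' z * (y - x) < 0" by simp
    then have "g'' z < 0" using \<open>x < y\<close> by (simp add: mult_less_0_iff)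
    then have "c1 \<le> - g'' z" "- g'' z \<le> c2" using bounds[OF z(1)] by auto
    then have "c1 * (y - x) \<le> - g'' z * (y - x)" "- g'' z * (y - x) \<le> c2 * (y - x)"
      by (intro mult_right_mono; use \<open>x < y\<close> in simp)+
    then show ?thesis using z(2) by simp
  qed simp
  show ?thesis
    by unfold_locales (use assms cont slope in auto)
qed

section \<open>Comparison with the sum over coprime pairs\<close>

theorem theorem5:
  fixes g g' g'' :: "real \<Rightarrow> real" and c1 c2 :: real
    and \<alpha> \<beta> \<gamma>10 \<alpha>' \<beta>' \<gamma>01 :: real
  assumes "\<And>x. x \<in> {0..1} \<Longrightarrow> (g has_real_derivative g' x) (at x within {0..1})"
    and "\<And>x. x \<in> {0..1} \<Longrightarrow> (g' has_real_derivative g'' x) (at x within {0..1})"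
    and "g' 0 = 0" and "g' 1 = -1"
    and "0 < c1" and "\<And>x. x \<in> {0..1} \<Longrightarrow> c1 \<le> \<bar>g'' x\<bar> \<and> \<bar>g'' x\<bar> < c2"
    and "admissible_choice g \<alpha> \<beta> \<gamma>10 \<alpha>' \<beta>' \<gamma>01"
  shows "(\<forall>s>2/3. F_Gamma_converges g \<alpha> \<beta> \<alpha>' \<beta>' s) \<and>
         \<not> F_Gamma_converges g \<alpha> \<beta> \<alpha>' \<beta>' (2/3)"
proof -
  let ?C = "{(m, n). 0 < m \<and> 0 < n \<and> coprime m n} :: (nat \<times> nat) set"
  let ?S = "\<lambda>(a, b, c, d). (a + b, c + d) :: nat \<times> nat"
  interpret concave_arc g g' c1 c2 using assms(1-6) by (rule concave_arcI)
  from admissible_choice_cases[OF assms(7)]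
  have "0 < \<alpha>" and eqs: "\<beta> = \<alpha>" "\<alpha>' = 0" "\<beta>' = 1 / \<alpha>" by auto
  define f where "f = (\<lambda>(a, b, c, d). f_Gamma g \<alpha> \<alpha> 0 (1 / \<alpha>) a b c d)"
  obtain k K where kK: "0 < k" "0 < K" and
    "\<And>a b c d. (a, b, c, d) \<in> unimodular_quadruples \<Longrightarrow>
       k / cubic_form (a + b, c + d) \<le> f_Gamma g \<alpha> \<alpha> 0 (1 / \<alpha>) a b c d \<and>
       f_Gamma g \<alpha> \<alpha> 0 (1 / \<alpha>) a b c d \<le> K / cubic_form (a + b, c + d)"
    using f_Gamma_comparable[OF \<open>0 < \<alpha>\<close>] by blast
  then have bounds: "k / cubic_form (?S x) \<le> f x \<and> f x \<le> K / cubic_form (?S x)"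
    if "x \<in> unimodular_quadruples" for x
    using that by (cases x) (simp add: f_def)
  have converges_iff: "F_Gamma_converges g \<alpha> \<beta> \<alpha>' \<beta>' s \<longleftrightarrow>
      (\<lambda>x. f x powr s) summable_on unimodular_quadruples" for s
    by (simp add: F_Gamma_converges_def f_def eqs case_prod_unfold)
  have reindex: "(\<lambda>x. cubic_form (?S x) powr - s) summable_on unimodular_quadruples
      \<longleftrightarrow> (\<lambda>p. cubic_form p powr - s) summable_on ?C" for s
    by (rule summable_on_reindex_bij_betw[OF bij_betw_unimodular_quadruples])
  have powr_quotient: "(r / cubic_form p) powr s = r powr s * cubic_form p powr - s" if "0 < r" for r p s
    using that cubic_form_nonneg[of p] by (simp add: powr_divide powr_minus_divide)
  have quotient_nonneg: "0 \<le> r / cubic_form p" if "0 < r" for r p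
    using that cubic_form_nonneg[of p] by simp
  show ?thesis
  proof (intro conjI allI impI notI)
    fix s :: real assume s: "2 / 3 < s"
    have "(\<lambda>p. cubic_form p powr - s) summable_on ?C"
      using summable_on_cubic_form_powr[OF s] by (rule summable_on_subset_banach) simp
    then have "(\<lambda>x. K powr s * cubic_form (?S x) powr - s) summable_on unimodular_quadruples"
      unfolding reindex[symmetric] by (rule summable_on_cmult_right)
    then show "F_Gamma_converges g \<alpha> \<beta> \<alpha>' \<beta>' s"
      unfolding converges_iff
    proof (rule summable_on_comparison_test)
      fix x assume x: "x \<in> unimodular_quadruples"
      show "f x powr s \<le> K powr s * cubic_form (?S x) powr - s"
        unfolding powr_quotient[OF kK(2), symmetric]
        using bounds[OF x] quotient_nonneg[OF kK(1), of "?S x"] s by (intro powr_mono2) auto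
    qed simp
  next
    assume "F_Gamma_converges g \<alpha> \<beta> \<alpha>' \<beta>' (2 / 3)"
    then have "(\<lambda>x. f x powr (2 / 3)) summable_on unimodular_quadruples"
      unfolding converges_iff .
    \<comment> \<open>For divergence the lower bound carries summability over to the cubic form on
      coprime pairs.\<close>
    then have "(\<lambda>x. k powr (2 / 3) * cubic_form (?S x) powr - (2 / 3)) summable_on unimodular_quadruples"
    proof (rule summable_on_comparison_test)
      fix x assume x: "x \<in> unimodular_quadruples"
      show "k powr (2 / 3) * cubic_form (?S x) powr - (2 / 3) \<le> f x powr (2 / 3)"
        unfolding powr_quotient[OF kK(1), symmetric]
        using bounds[OF x] quotient_nonneg[OF kK(1)] by (intro powr_mono2) auto
    qed simp
    then have "(\<lambda>x. cubic_form (?S x) powr - (2 / 3)) summable_on unimodular_quadruples"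
      using kK(1) by (subst (asm) summable_on_cmult_right') auto
    then show False
      unfolding reindex using not_summable_on_cubic_form_powr_coprime by blast
  qed
qed

end
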